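(* Let $d,n,N,s\ge 1$ be integers, let $r_{\max}>r_{\min}>0$ and $\epsilon>0$, and let $\mathbf{X}^{(1)},\dots,\mathbf{X}^{(N)}\in\mathbb{R}^{d\times n}$ be input sequences with no duplicate word token in each sequence, that is, $\mathbf{X}^{(i)}_{:,k}\neq\mathbf{X}^{(i)}_{:,l}$ for any $i\in[N]$ and $k,l\in[n]$ with $k\ne l$. Assume also that $\mathbf{X}^{(1)},\dots,\mathbf{X}^{(N)}$ are tokenwise $(r_{\min},r_{\max},\epsilon)$-separated. Then there exist weight matrices $\mathbf{W}^{(O)}\in\mathbb{R}^{d\times s}$ and $\mathbf{W}^{(V)},\mathbf{W}^{(K)},\mathbf{W}^{(Q)}\in\mathbb{R}^{s\times d}$ such that the ranks of $\mathbf{W}^{(V)}$, $\mathbf{W}^{(K)}$ and $\mathbf{W}^{(Q)}$ are all $1$, and the one-layer single-head softmax attention $$\mathcal{F}^{(SA)}_S(\mathbf{Z})=\mathbf{Z}+\mathbf{W}^{(O)}\left(\mathbf{W}^{(V)}\mathbf{Z}\right)\sigma_S\left[\left(\mathbf{W}^{(K)}\mathbf{Z}\right)^\top\left(\mathbf{W}^{(Q)}\mathbf{Z}\right)\right],\qquad \mathbf{Z}\in\mathbb{R}^{d\times n},$$ is an $(r,\delta)$-contextual mapping for the input sequences $\mathbf{X}^{(1)},\dots,\mathbf{X}^{(N)}$ with $$r=r_{\max}+\frac{\epsilon}{4},$$ $$\delta=\frac{2(\log n)^2\epsilon^2 r_{\min}}{r_{\max}^2(|\mathcal{V}|+1)^4(2\log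 n+3)\pi d}\exp\left(-(|\mathcal{V}|+1)^4\,\frac{(2\log n+3)\pi d\, r_{\max}^2}{4\epsilon r_{\min}}\right).$$
   Context: $[m]=\{1,\dots,m\}$; $\|\cdot\|$ is the $\ell^2$ norm; $\log$ is the natural logarithm; $\mathbf{A}_{:,k}$ is the $k$-th column of $\mathbf{A}$. $\sigma_S$ is the softmax function, $\sigma_S[\mathbf{v}]_i=e^{v_i}/\sum_j e^{v_j}$, applied column by column to matrices. Vocabulary sets: $\mathcal{V}^{(i)}=\{\mathbf{X}^{(i)}_{:,k}:k\in[n]\}\subset\mathbb{R}^d$ and $\mathcal{V}=\bigcup_{i\in[N]}\mathcal{V}^{(i)}$. Tokenwise separatedness: $\mathbf{X}^{(1)},\dots,\mathbf{X}^{(N)}$ are tokenwise $(r_{\min},r_{\max},\epsilon)$-separated if (1) $\|\mathbf{X}^{(i)}_{:,k}\|>r_{\min}$ and (2) $\|\mathbf{X}^{(i)}_{:,k}\|<r_{\max}$ for all $i\in[N]$, $k\in[n]$, and (3) $\|\mathbf{X}^{(i)}_{:,k}-\mathbf{X}^{(j)}_{:,l}\|>\epsilon$ for all $i,j\in[N]$, $k,l\in[n]$ with $\mathbf{X}^{(i)}_{:,k}\ne\mathbf{X}^{(j)}_{:,l}$. Contextual mapping: a map $q:\mathbb{R}^{d\times n}\to\mathbb{R}^{d\times n}$ is an $(r,\delta)$-contextual mapping for $\mathbf{X}^{(1)},\dots,\mathbf{X}^{(N)}$ if (1) $\|q(\mathbf{X}^{(i)})_{:,k}\|<r$ for all $i\in[N]$,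 $k\in[n]$; and (2) for all $i,j\in[N]$ and $k,l\in[n]$ such that $\mathcal{V}^{(i)}\ne\mathcal{V}^{(j)}$ or $\mathbf{X}^{(i)}_{:,k}\ne\mathbf{X}^{(j)}_{:,l}$, one has $\|q(\mathbf{X}^{(i)})_{:,k}-q(\mathbf{X}^{(j)})_{:,l}\|>\delta$. *)

theory Defs
  imports "HOL-Analysis.Analysis"
begin

text \<open>
  A \<open>d \<times> n\<close> matrix is an element of \<open>real ^ 'n ^ 'd\<close>, with \<open>d = CARD('d)\<close> and \<open>n = CARD('n)\<close>.
  Input sequences are \<open>X i\<close> for \<open>i \<in> {1..N}\<close>; the values of \<open>X\<close> outside this range are irrelevant.
  The vocabulary set of a single sequence \<open>A\<close> is the library's \<open>columns A\<close>.
\<close>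

definition vocabulary :: "nat \<Rightarrow> (nat \<Rightarrow> real ^ 'n ^ 'd) \<Rightarrow> (real ^ 'd) set" where
  "vocabulary N X = (\<Union>i\<in>{1..N}. columns (X i))"

definition tokenwise_separated ::
  "real \<Rightarrow> real \<Rightarrow> real \<Rightarrow> nat \<Rightarrow> (nat \<Rightarrow> real ^ 'n ^ 'd) \<Rightarrow> bool" where
  "tokenwise_separated rmin rmax \<epsilon> N X \<longleftrightarrow>
     (\<forall>i\<in>{1..N}. \<forall>k. norm (column k (X i)) > rmin) \<and>
     (\<forall>i\<in>{1..N}. \<forall>k. norm (column k (X i)) < rmax) \<and>
     (\<forall>i\<in>{1..N}. \<forall>j\<in>{1..N}. \<forall>k l.
        column k (X i) \<noteq> column l (X j) \<longrightarrow>
        norm (column k (X i) - column l (X j)) > \<epsilon>)"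

definition contextual_mapping ::
  "real \<Rightarrow> real \<Rightarrow> nat \<Rightarrow> (nat \<Rightarrow> real ^ 'n ^ 'd) \<Rightarrow>
   (real ^ 'n ^ 'd \<Rightarrow> real ^ 'n ^ 'd) \<Rightarrow> bool" where
  "contextual_mapping r \<delta> N X q \<longleftrightarrow>
     (\<forall>i\<in>{1..N}. \<forall>k. norm (column k (q (X i))) < r) \<and>
     (\<forall>i\<in>{1..N}. \<forall>j\<in>{1..N}. \<forall>k l.
        columns (X i) \<noteq> columns (X j) \<or> column k (X i) \<noteq> column l (X j) \<longrightarrow>
        norm (column k (q (X i)) - column l (q (X j))) > \<delta>)"

definition softmax :: "real ^ 'm \<Rightarrow> real ^ 'm" where
  "softmax v = (\<chi> i. exp (v $ i) / (\<Sum>j\<in>UNIV. exp (v $ j)))"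

definition softmax_columns :: "real ^ 'n ^ 'm \<Rightarrow> real ^ 'n ^ 'm" where
  "softmax_columns A = (\<chi> i k. softmax (column k A) $ i)"

definition self_attention ::
  "real ^ 's ^ 'd \<Rightarrow> real ^ 'd ^ 's \<Rightarrow> real ^ 'd ^ 's \<Rightarrow> real ^ 'd ^ 's \<Rightarrow>
   real ^ 'n ^ 'd \<Rightarrow> real ^ 'n ^ 'd" where
  "self_attention WO WV WK WQ Z =
     Z + WO ** (WV ** Z) ** softmax_columns (transpose (WK ** Z) ** (WQ ** Z))"

end

theory Submission imports Defs
begin

text \<open>
  All weight matrices are outer products with a unit vector \<open>v\<close> that separates the tokens and
  \<open>0\<close> pairwise: \<open>\<bar>v \<bullet> (x - y)\<bar> \<ge> sqrt (8 / (pi * d)) / (card V + 1)\<^sup>2 * norm (x - y)\<close>. Such a \<open>v\<close>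
  exists by a union bound: the slabs of the unit ball that have to be avoided have too little volume
  to cover it. The attention scores of a query token \<open>x\<close> are then the numbers
  \<open>c * (v \<bullet> x) * (v \<bullet> y)\<close>, and \<open>c\<close> is chosen such that different scores are more than
  \<open>2 * ln n + 3\<close> apart. The output at \<open>x\<close> is \<open>x\<close> plus a short vector proportional to the Boltzmann
  average (the softmax-weighted mean) of the scores.

  Short vectors do not destroy the separation of different tokens. For equal tokens in sequences with
  different vocabularies one compares the Boltzmann averages of two different score sets. Let \<open>z\<close> be
  the maximum of their symmetric difference. If no score exceeds \<open>z\<close>, then the average of the set
  containing \<open>z\<close> is close to \<open>z\<close> and the other one is far below. Otherwise both averages fall short
  of the average of the common scores above \<open>z\<close>, and the set containing \<open>z\<close> has the larger shortfall
  because \<open>u * exp (- u)\<close> is decreasing for \<open>u \<ge> 1\<close>.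
\<close>

section \<open>Separating directions\<close>

lemma emeasure_PiM_cylinder:
  assumes "finite A" "i \<notin> A" "t \<ge> 0"
  shows "emeasure (Pi\<^sub>M (insert i A) (\<lambda>_. lborel))
           ({f. \<bar>f i\<bar> \<le> t \<and> sqrt (\<Sum>j\<in>A. (f j)\<^sup>2) \<le> 1} \<inter> space (Pi\<^sub>M (insert i A) (\<lambda>_. lborel)))
         = ennreal (2 * t * unit_ball_vol (real (card A)))"
    (is "emeasure ?M ?C = _")
proof -
  interpret product_sigma_finite "\<lambda>_. lborel :: real measure"
    by standard
  let ?B = "{f. sqrt (\<Sum>j\<in>A. (f j)\<^sup>2) \<le> 1} \<inter> space (Pi\<^sub>M A (\<lambda>_. lborel :: real measure))"
  have "emeasure ?M ?C = (\<integral>\<^sup>+ f. indicator ?C f \<partial>?M)"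
    using assms by (subst nn_integral_indicator) auto
  \<comment> \<open>Coordinate \<open>i\<close> is split off, which turns the cylinder into an
    interval times a ball.\<close>
  also have "\<dots> = (\<integral>\<^sup>+ y. \<integral>\<^sup>+ f. indicator ?C (f(i := y)) \<partial>Pi\<^sub>M A (\<lambda>_. lborel) \<partial>lborel)"
    using assms by (subst product_nn_integral_insert_rev) auto
  also have "\<dots> = (\<integral>\<^sup>+ y. \<integral>\<^sup>+ f. indicator {-t..t} y * indicator ?B f \<partial>Pi\<^sub>M A (\<lambda>_. lborel) \<partial>lborel)"
  proof (intro nn_integral_cong)
    fix y :: real and f assume f: "f \<in> space (Pi\<^sub>M A (\<lambda>_. lborel :: real measure))"
    have "(\<Sum>j\<in>A. (if j = i then y else f j)\<^sup>2) = (\<Sum>j\<in>A. (f j)\<^sup>2)"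
      using assms by (intro sum.cong) auto
    then show "indicator ?C (f(i := y)) = (indicator {-t..t} y * indicator ?B f :: ennreal)"
      using f by (auto simp: indicator_def PiE_def space_PiM abs_le_iff)
  qed
  also have "\<dots> = (\<integral>\<^sup>+ y. indicator {-t..t} y * emeasure (Pi\<^sub>M A (\<lambda>_. lborel)) ?B \<partial>lborel)"
    using assms by (intro nn_integral_cong, subst nn_integral_cmult_indicator) auto
  also have "\<dots> = ennreal (2 * t) * emeasure (Pi\<^sub>M A (\<lambda>_. lborel)) ?B"
    using assms by (subst nn_integral_multc) auto
  also have "emeasure (Pi\<^sub>M A (\<lambda>_. lborel)) ?B = ennreal (unit_ball_vol (real (card A)))"
    using emeasure_cball_aux[OF assms(1), of 1] by simp
  finally show ?thesis
    using assms by (simp add: ennreal_mult)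
qed

text \<open>Dropping the coordinate along \<open>b\<close> cannot lengthen a vector, so the slab
  lies in a cylinder over the unit ball of one dimension less.\<close>

lemma emeasure_Basis_slab_le:
  fixes b :: "'a :: euclidean_space"
  assumes "b \<in> Basis" "t \<ge> 0"
  shows "emeasure lborel {u :: 'a. norm u \<le> 1 \<and> \<bar>u \<bullet> b\<bar> \<le> t}
         \<le> ennreal (2 * t * unit_ball_vol (real (DIM('a) - 1)))"
proof -
  let ?A = "Basis - {b}"
  let ?M = "Pi\<^sub>M Basis (\<lambda>_. lborel) :: ('a \<Rightarrow> real) measure"
  have ins: "insert b ?A = Basis"
    using assms by auto
  have meas: "{u :: 'a. norm u \<le> 1 \<and> \<bar>u \<bullet> b\<bar> \<le> t} \<in> sets borel"
    by measurable
  have "emeasure lborel {u :: 'a. norm u \<le> 1 \<and> \<bar>u \<bullet> b\<bar> \<le> t} =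
    emeasure ?M ((\<lambda>f. \<Sum>b\<in>Basis. f b *\<^sub>R b) -` {u :: 'a. norm u \<le> 1 \<and> \<bar>u \<bullet> b\<bar> \<le> t} \<inter> space ?M)"
    by (subst lborel_eq, subst emeasure_distr) (use meas in auto)
  also have "\<dots> \<le> emeasure ?M ({f. \<bar>f b\<bar> \<le> t \<and> sqrt (\<Sum>j\<in>?A. (f j)\<^sup>2) \<le> 1} \<inter> space ?M)"
  proof (rule emeasure_mono)
    show "{f. \<bar>f b\<bar> \<le> t \<and> sqrt (\<Sum>j\<in>?A. (f j)\<^sup>2) \<le> 1} \<inter> space ?M \<in> sets ?M"
      using assms(1) by measurable
    have "sqrt (\<Sum>j\<in>?A. (f j)\<^sup>2) \<le> 1" if "norm (\<Sum>b\<in>Basis. f b *\<^sub>R b :: 'a) \<le> 1" for f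
    proof -
      have "norm (\<Sum>b\<in>Basis. f b *\<^sub>R b :: 'a) = sqrt (\<Sum>j\<in>Basis. (f j)\<^sup>2)"
        using euclidean_dist_l2[of "\<Sum>b\<in>Basis. f b *\<^sub>R b :: 'a" 0] by (simp add: L2_set_def)
      moreover have "(\<Sum>j\<in>?A. (f j)\<^sup>2) \<le> (\<Sum>j\<in>Basis. (f j)\<^sup>2)"
        by (intro sum_mono2) auto
      ultimately show ?thesis
        using that by (smt (verit) real_sqrt_le_iff)
    qed
    then show "(\<lambda>f. \<Sum>b\<in>Basis. f b *\<^sub>R b) -` {u :: 'a. norm u \<le> 1 \<and> \<bar>u \<bullet> b\<bar> \<le> t} \<inter> space ?M
      \<subseteq> {f. \<bar>f b\<bar> \<le> t \<and> sqrt (\<Sum>j\<in>?A. (f j)\<^sup>2) \<le> 1} \<inter> space ?M"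
      using assms(1) by auto
  qed
  also have "\<dots> = ennreal (2 * t * unit_ball_vol (real (DIM('a) - 1)))"
    using emeasure_PiM_cylinder[of ?A b t, unfolded ins] assms by (simp add: card_Diff_singleton)
  finally show ?thesis .
qed

text \<open>A rotation turns a coordinate axis into the direction of \<open>x\<close>. It preserves
  the unit ball and Lebesgue measure, so a slab orthogonal to an axis suffices.\<close>

lemma slab_volume_le:
  fixes x :: "real ^ 'd :: {finite, wellorder}"
  assumes "x \<noteq> 0" "t \<ge> 0"
  shows "{u \<in> cball 0 1. \<bar>u \<bullet> x\<bar> \<le> t * norm x} \<in> lmeasurable"
    and "measure lebesgue {u \<in> cball 0 1. \<bar>u \<bullet> x\<bar> \<le> t * norm x}
         \<le> 2 * t * unit_ball_vol (real (CARD('d) - 1))"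
proof -
  fix k :: 'd
  define S where "S = {u :: real ^ 'd :: _. norm u \<le> 1 \<and> \<bar>u \<bullet> axis k 1\<bar> \<le> t}"
  obtain T where T: "orthogonal_transformation T" and Tx: "T (norm x *\<^sub>R axis k (1 :: real)) = x"
    using rotation_rightward_line by metis
  have "S = cball 0 1 \<inter> {u. \<bar>u \<bullet> axis k 1\<bar> \<le> t}"
    by (auto simp: S_def)
  moreover have "closed {u :: real ^ 'd :: _. \<bar>u \<bullet> axis k 1\<bar> \<le> t}"
    by (intro closed_Collect_le continuous_intros)
  ultimately have "compact S"
    using compact_Int_closed[OF compact_cball] by metis
  then have Sm: "S \<in> lmeasurable"
    by (rule lmeasurable_compact)
  have "emeasure lborel S \<le> ennreal (2 * t * unit_ball_vol (real (CARD('d) - 1)))"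
    unfolding S_def using emeasure_Basis_slab_le[of "axis k 1 :: real ^ 'd :: _" t] assms
    by (simp add: axis_in_Basis_iff)
  moreover have "emeasure lebesgue S = emeasure lborel S"
    using \<open>compact S\<close> by (simp add: compact_imp_closed)
  ultimately have le: "measure lebesgue S \<le> 2 * t * unit_ball_vol (real (CARD('d) - 1))"
    using assms(2) unfolding measure_def by (intro enn2real_leI) auto
  have inner: "\<bar>T u \<bullet> x\<bar> \<le> t * norm x \<longleftrightarrow> \<bar>u \<bullet> axis k 1\<bar> \<le> t" for u
  proof -
    have "T u \<bullet> x = T u \<bullet> T (norm x *\<^sub>R axis k 1)"
      by (simp only: Tx)
    also have "\<dots> = norm x * (u \<bullet> axis k 1)"
      using T by (simp add: orthogonal_transformation_def)
    finally show ?thesis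
      using assms(1) by (simp add: abs_mult mult.commute)
  qed
  have eq: "{u \<in> cball 0 1. \<bar>u \<bullet> x\<bar> \<le> t * norm x} = T ` S"
  proof (intro equalityI subsetI)
    fix w assume w: "w \<in> {u \<in> cball 0 1. \<bar>u \<bullet> x\<bar> \<le> t * norm x}"
    obtain u where u: "w = T u"
      using orthogonal_transformation_surj[OF T] by (metis surjD)
    then show "w \<in> T ` S"
      using w inner[of u] T by (auto simp: S_def orthogonal_transformation)
  qed (use inner T in \<open>auto simp: S_def orthogonal_transformation\<close>)
  show "{u \<in> cball 0 1. \<bar>u \<bullet> x\<bar> \<le> t * norm x} \<in> lmeasurable"
    unfolding eq by (rule measurable_orthogonal_image[OF T Sm])
  show "measure lebesgue {u \<in> cball 0 1. \<bar>u \<bullet> x\<bar> \<le> t * norm x}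
         \<le> 2 * t * unit_ball_vol (real (CARD('d) - 1))"
    unfolding eq using le by (simp add: measure_orthogonal_image[OF T Sm])
qed

text \<open>By \<open>vol\<close> the slabs together have less volume than the ball, so some
  \<open>u\<close> in the ball avoids them all. Scaling \<open>u\<close> up to length 1 can only
  enlarge \<open>\<bar>u \<bullet> x\<bar>\<close>.\<close>

lemma unit_vector_avoiding_slabs:
  fixes S :: "(real ^ 'd :: {finite, wellorder}) set"
  assumes "finite S" "0 \<notin> S" "t \<ge> 0"
    and vol: "real (card S) * (2 * t * unit_ball_vol (real (CARD('d) - 1))) < unit_ball_vol (real CARD('d))"
  obtains v where "norm v = 1" "\<And>x. x \<in> S \<Longrightarrow> t * norm x \<le> \<bar>v \<bullet> x\<bar>"
\<comment> \<open>With nothing to avoid, \<open>u\<close> could be 0 and could not be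
  normalized.\<close>
proof (cases "S = {}")
  case True
  show ?thesis
    by (rule that[of "axis undefined 1"]) (auto simp: True)
next
  case False
  define C where "C x = {u :: real ^ 'd :: _ \<in> cball 0 1. \<bar>u \<bullet> x\<bar> \<le> t * norm x}" for x
  have C: "C x \<in> lmeasurable" "measure lebesgue (C x) \<le> 2 * t * unit_ball_vol (real (CARD('d) - 1))"
    if "x \<in> S" for x
    using slab_volume_le[of x t] that assms(2,3) unfolding C_def by auto
  have "\<not> cball 0 1 \<subseteq> (\<Union>x\<in>S. C x)"
  proof
    assume "cball 0 1 \<subseteq> (\<Union>x\<in>S. C x)"
    then have "measure lebesgue (cball 0 1 :: (real ^ 'd :: _) set) \<le> measure lebesgue (\<Union>x\<in>S. C x)"
      using C(1) assms(1) by (intro measure_mono_fmeasurable fmeasurable.finite_UN) auto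
    also have "\<dots> \<le> (\<Sum>x\<in>S. measure lebesgue (C x))"
      using C(1) assms(1) by (intro measure_UNION_le) (auto intro: fmeasurableD)
    also have "\<dots> \<le> (\<Sum>x\<in>S. 2 * t * unit_ball_vol (real (CARD('d) - 1)))"
      by (intro sum_mono C(2))
    also have "\<dots> < unit_ball_vol (real CARD('d))"
      using vol by simp
    also have "\<dots> = measure lebesgue (cball 0 1 :: (real ^ 'd :: _) set)"
      using content_cball[of 1 "0 :: real ^ 'd :: _"] by simp
    finally show False by simp
  qed
  then obtain u :: "real ^ 'd :: _" where "u \<in> cball 0 1" "u \<notin> (\<Union>x\<in>S. C x)"
    by blast
  then have u: "norm u \<le> 1" and gt: "\<And>x. x \<in> S \<Longrightarrow> t * norm x < \<bar>u \<bullet> x\<bar>"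
    by (auto simp: C_def not_le)
  have "u \<noteq> 0"
    using False gt assms(3) by (metis abs_zero all_not_in_conv inner_zero_left leD mult_nonneg_nonneg norm_ge_zero)
  show ?thesis
  proof (rule that)
    show "norm (u /\<^sub>R norm u) = 1"
      using \<open>u \<noteq> 0\<close> by simp
    fix x assume "x \<in> S"
    have "t * norm x \<le> \<bar>u \<bullet> x\<bar>"
      using gt[OF \<open>x \<in> S\<close>] by simp
    also have "\<dots> \<le> \<bar>u \<bullet> x\<bar> / norm u"
      using u \<open>u \<noteq> 0\<close> by (simp add: field_simps mult_left_le_one_le)
    also have "\<dots> = \<bar>(u /\<^sub>R norm u) \<bullet> x\<bar>"
      by (simp add: abs_mult divide_inverse mult.commute)
    finally show "t * norm x \<le> \<bar>(u /\<^sub>R norm u) \<bullet> x\<bar>" .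
  qed
qed

section \<open>Ratio of the volumes of unit balls in consecutive dimensions\<close>

lemma Gamma_plus_half_le:
  fixes x :: real
  assumes "x > 0"
  shows "Gamma (x + 1/2) \<le> sqrt x * Gamma x"
proof -
  \<comment> \<open>Log-convexity of \<open>Gamma\<close> at \<open>x + 1/2\<close>, the midpoint of
    \<open>x\<close> and \<open>x + 1\<close>.\<close>
  have "ln (Gamma (x + 1/2)) \<le> 1/2 * ln (Gamma x) + 1/2 * ln (Gamma (x + 1))"
    using convex_onD[OF log_convex_Gamma_real, of "1/2" x "x + 1"] assms
    by (simp add: algebra_simps add_divide_distrib)
  also have "Gamma (x + 1) = x * Gamma x"
    using assms by (intro Gamma_plus1) (auto elim!: nonpos_Ints_cases)
  also have "1/2 * ln (Gamma x) + 1/2 * ln (x * Gamma x) = ln (sqrt x * Gamma x)"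
    using assms Gamma_real_pos[OF assms] by (simp add: ln_mult ln_sqrt field_simps)
  finally show ?thesis
    using assms by (subst (asm) ln_le_cancel_iff) (auto simp: Gamma_real_pos)
qed

text \<open>With \<open>x = (n + 1) / 2\<close>, the quotient of the two volumes is
  \<open>Gamma (x + 1/2) / (sqrt pi * Gamma x)\<close>.\<close>

lemma unit_ball_vol_ratio:
  assumes "n \<ge> 1"
  shows "unit_ball_vol (real (n - 1)) \<le> sqrt ((real n + 1) / (2 * pi)) * unit_ball_vol (real n)"
proof -
  define x where "x = (real n + 1) / 2"
  have x: "x > 0" "real n / 2 + 1 = x + 1/2" "real (n - 1) / 2 + 1 = x" "real n / 2 = real (n - 1) / 2 + 1/2"
    "(real n + 1) / (2 * pi) = x / pi"
    using assms by (auto simp: x_def field_simps of_nat_diff)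
  have "1 / Gamma x \<le> sqrt x / Gamma (x + 1/2)"
    using Gamma_plus_half_le[OF x(1)] x(1) by (simp add: field_simps Gamma_real_pos)
  also have "\<dots> = sqrt (x / pi) * (sqrt pi / Gamma (x + 1/2))"
    by (simp add: real_sqrt_divide)
  finally have "1 / Gamma x \<le> sqrt (x / pi) * (sqrt pi / Gamma (x + 1/2))" .
  then have "pi powr (real (n - 1) / 2) * (1 / Gamma x)
      \<le> pi powr (real (n - 1) / 2) * (sqrt (x / pi) * (sqrt pi / Gamma (x + 1/2)))"
    by (intro mult_left_mono) auto
  then show ?thesis
    unfolding unit_ball_vol_def x(2,3,5)
    by (subst x(4)) (simp add: powr_add powr_half_sqrt mult_ac)
qed

text \<open>A vector and its negative define the same slab, so it suffices to avoid one difference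
  per unordered pair.\<close>

lemma difference_representatives:
  fixes V :: "'a :: ab_group_add set"
  assumes "finite V"
  shows "\<exists>S. finite S \<and> 0 \<notin> S \<and> 2 * card S \<le> card V * (card V - 1) \<and>
           (\<forall>x\<in>V. \<forall>y\<in>V. x \<noteq> y \<longrightarrow> x - y \<in> S \<or> y - x \<in> S)"
  using assms
proof (induction V)
  case empty
  then show ?case by (intro exI[of _ "{}"]) auto
next
  case (insert a V)
  then obtain S where S: "finite S" "0 \<notin> S" "2 * card S \<le> card V * (card V - 1)"
    "\<forall>x\<in>V. \<forall>y\<in>V. x \<noteq> y \<longrightarrow> x - y \<in> S \<or> y - x \<in> S"
    by blast
  let ?S = "S \<union> (\<lambda>x. a - x) ` V"
  have "card ?S \<le> card S + card V"
    using card_Un_le[of S "(\<lambda>x. a - x) ` V"] card_image_le[OF insert.hyps(1), of "\<lambda>x. a - x"] by linarith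
  then have "2 * card ?S \<le> card V * (card V - 1) + 2 * card V"
    using S(3) by linarith
  also have "\<dots> = card (insert a V) * (card (insert a V) - 1)"
    using insert.hyps by (cases "card V") auto
  finally show ?case
    using S insert.hyps by (intro exI[of _ ?S]) auto
qed

text \<open>The library proves invariance of Lebesgue measure under orthogonal maps only for vectors
  over a well-ordered index type. The result carries over to arbitrary finite index types by
  copying the index type and ordering the copy.\<close>
typedef 'a well_ordered = "UNIV :: 'a set" ..

instance well_ordered :: (finite) finite
proof
  show "finite (UNIV :: 'a well_ordered set)"
    by (rule finite_imageD[of Rep_well_ordered]) (auto simp: inj_on_def Rep_well_ordered_inject)
qed

instantiation well_ordered :: (finite) wellorder
begin

definition less_eq_well_ordered :: "'a well_ordered \<Rightarrow> 'a well_ordered \<Rightarrow> bool" where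
  "x \<le> y \<longleftrightarrow> to_nat (Rep_well_ordered x) \<le> to_nat (Rep_well_ordered y)"

definition less_well_ordered :: "'a well_ordered \<Rightarrow> 'a well_ordered \<Rightarrow> bool" where
  "x < y \<longleftrightarrow> to_nat (Rep_well_ordered x) < to_nat (Rep_well_ordered y)"

instance
proof
  fix P and a :: "'a well_ordered"
  assume step: "\<And>x :: 'a well_ordered. (\<And>y. y < x \<Longrightarrow> P y) \<Longrightarrow> P x"
  show "P a"
    by (induction a rule: measure_induct_rule[of "\<lambda>x. to_nat (Rep_well_ordered x)"])
      (auto intro: step simp: less_well_ordered_def)
qed (auto simp: less_eq_well_ordered_def less_well_ordered_def Rep_well_ordered_inject)

end

text \<open>The union bound runs over unordered pairs: counting ordered pairs would lose a factor 2,
  whereas the available slack is only \<open>pi / 2 * sqrt (d / (d + 1))\<close>.\<close>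
lemma exists_separating_direction_wellorder:
  fixes V :: "(real ^ 'd :: {finite, wellorder}) set"
  assumes "finite V"
  obtains v where "norm v = 1"
    "\<And>x y. x \<in> V \<Longrightarrow> y \<in> V \<Longrightarrow>
       sqrt (8 / (pi * real CARD('d))) / real (card V) ^ 2 * norm (x - y) \<le> \<bar>v \<bullet> (x - y)\<bar>"
proof -
  define M where "M = real (card V)"
  define d where "d = real CARD('d)"
  define t where "t = sqrt (8 / (pi * d)) / M ^ 2"
  have d1: "d \<ge> 1"
    unfolding d_def by (simp add: Suc_leI)
  have t0: "t \<ge> 0"
    using d1 by (simp add: t_def)
  obtain S where S: "finite S" "0 \<notin> S" "2 * card S \<le> card V * (card V - 1)"
    "\<And>x y. x \<in> V \<Longrightarrow> y \<in> V \<Longrightarrow> x \<noteq> y \<Longrightarrow> x - y \<in> S \<or> y - x \<in> S"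
    using difference_representatives[OF assms] by metis
  have "2 * real (card S) \<le> real (card V * (card V - 1))"
    using S(3) by (metis of_nat_le_iff of_nat_mult of_nat_numeral)
  also have "\<dots> \<le> M ^ 2"
    by (simp add: M_def power2_eq_square mult_left_mono)
  finally have cS: "2 * real (card S) \<le> M ^ 2" .
  \<comment> \<open>Squared, this reads \<open>4 * (d + 1) < pi * pi * d\<close>.\<close>
  have ratio: "sqrt (8 / (pi * d)) * sqrt ((d + 1) / (2 * pi)) < 1"
  proof -
    have "(3::real) * 3 < pi * pi"
      using pi_gt3 by (intro mult_strict_mono) auto
    then have "9 * d < (pi * pi) * d"
      using d1 by (intro mult_strict_right_mono) auto
    moreover have "4 * (d + 1) \<le> 9 * d"
      using d1 by simp
    ultimately have "4 * (d + 1) < pi * pi * d"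
      by (rule order.strict_trans1[rotated])
    then have "8 / (pi * d) * ((d + 1) / (2 * pi)) < 1"
      using d1 by (simp add: divide_simps) (simp add: algebra_simps)
    then show ?thesis
      by (simp flip: real_sqrt_mult)
  qed
  let ?w = "unit_ball_vol d"
  have w: "unit_ball_vol (real (CARD('d) - 1)) \<le> sqrt ((d + 1) / (2 * pi)) * ?w"
    unfolding d_def by (rule unit_ball_vol_ratio) (simp add: Suc_leI)
  have "?w > 0"
    using d1 by (intro unit_ball_vol_pos) simp
  have "real (card S) * (2 * t * unit_ball_vol (real (CARD('d) - 1))) =
      (2 * real (card S)) * t * unit_ball_vol (real (CARD('d) - 1))"
    by simp
  also have "\<dots> \<le> M ^ 2 * t * (sqrt ((d + 1) / (2 * pi)) * ?w)"
    using w cS t0 by (intro mult_mono) auto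
  \<comment> \<open>The powers of \<open>M\<close> cancel, except for empty \<open>V\<close>, where
    division by zero makes \<open>t\<close> zero.\<close>
  also have "\<dots> \<le> (sqrt (8 / (pi * d)) * sqrt ((d + 1) / (2 * pi))) * ?w"
    using d1 \<open>?w > 0\<close> by (cases "M = 0") (auto simp: t_def)
  also have "\<dots> < 1 * ?w"
    using ratio \<open>?w > 0\<close> by (intro mult_strict_right_mono)
  finally have vol: "real (card S) * (2 * t * unit_ball_vol (real (CARD('d) - 1))) < unit_ball_vol (real CARD('d))"
    by (simp add: d_def)
  obtain v where v: "norm v = 1" "\<And>x. x \<in> S \<Longrightarrow> t * norm x \<le> \<bar>v \<bullet> x\<bar>"
    using unit_vector_avoiding_slabs[OF S(1,2) t0 vol] by blast
  show ?thesis
  proof (rule that[OF v(1)])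
    fix x y assume xy: "x \<in> V" "y \<in> V"
    have "t * norm (x - y) \<le> \<bar>v \<bullet> (x - y)\<bar>"
    proof (cases "x = y")
      case False
      then consider "x - y \<in> S" | "y - x \<in> S"
        using S(4) xy by blast
      then show ?thesis
      proof cases
        case 2
        then show ?thesis
          using v(2)[of "y - x"] by (simp add: norm_minus_commute inner_diff_right abs_minus_commute)
      qed (use v(2) in auto)
    qed auto
    then show "sqrt (8 / (pi * real CARD('d))) / real (card V) ^ 2 * norm (x - y) \<le> \<bar>v \<bullet> (x - y)\<bar>"
      by (simp add: t_def M_def d_def)
  qed
qed

lemma exists_separating_direction:
  fixes V :: "(real ^ 'd) set"
  assumes "finite V"
  obtains v where "norm v = 1"
    "\<And>x y. x \<in> V \<Longrightarrow> y \<in> V \<Longrightarrow>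
       sqrt (8 / (pi * real CARD('d))) / real (card V) ^ 2 * norm (x - y) \<le> \<bar>v \<bullet> (x - y)\<bar>"
proof -
  \<comment> \<open>Renaming coordinates is a linear isometry, so the direction found for the copied
    index type can be pulled back.\<close>
  define \<phi> :: "real ^ 'd \<Rightarrow> real ^ 'd well_ordered" where "\<phi> x = (\<chi> i. x $ Rep_well_ordered i)" for x
  have bij: "bij_betw (Rep_well_ordered :: 'd well_ordered \<Rightarrow> 'd) UNIV UNIV"
    by (metis bijI' Rep_well_ordered_inject Abs_well_ordered_inverse UNIV_I)
  have card_eq: "CARD('d well_ordered) = CARD('d)"
    by (rule bij_betw_same_card[OF bij])
  have inner: "\<phi> x \<bullet> \<phi> y = x \<bullet> y" for x y
    using sum.reindex_bij_betw[OF bij, of "\<lambda>i. x $ i * y $ i"] by (simp add: \<phi>_def inner_vec_def)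
  have norm: "norm (\<phi> x) = norm x" for x
    by (simp add: norm_eq_sqrt_inner inner)
  have diff: "\<phi> x - \<phi> y = \<phi> (x - y)" for x y
    by (simp add: \<phi>_def vec_eq_iff)
  have "inj \<phi>"
    by (metis diff injI norm norm_eq_zero right_minus_eq)
  then have card_V: "card (\<phi> ` V) = card V"
    by (metis card_image inj_on_subset subset_UNIV)
  obtain w where w: "norm w = 1"
    "\<And>x y. x \<in> \<phi> ` V \<Longrightarrow> y \<in> \<phi> ` V \<Longrightarrow>
       sqrt (8 / (pi * real CARD('d))) / real (card V) ^ 2 * norm (x - y) \<le> \<bar>w \<bullet> (x - y)\<bar>"
    using exists_separating_direction_wellorder[of "\<phi> ` V"] assms unfolding card_eq card_V by blast
  define v :: "real ^ 'd" where "v = (\<chi> j. w $ Abs_well_ordered j)"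
  have "w = \<phi> v"
    by (simp add: \<phi>_def v_def vec_eq_iff Rep_well_ordered_inverse)
  show ?thesis
  proof (rule that[of v])
    show "norm v = 1"
      using w(1) by (simp add: \<open>w = \<phi> v\<close> norm)
    show "sqrt (8 / (pi * real CARD('d))) / real (card V) ^ 2 * norm (x - y) \<le> \<bar>v \<bullet> (x - y)\<bar>"
      if "x \<in> V" "y \<in> V" for x y
      using w(2)[of "\<phi> x" "\<phi> y"] that by (simp add: \<open>w = \<phi> v\<close> norm inner diff)
  qed
qed

section \<open>Boltzmann averages\<close>

text \<open>Taken over a set, since for distinct scores only their set matters; this links the
  averages to the vocabulary sets.\<close>

definition boltzmann :: "real set \<Rightarrow> real" where
  "boltzmann A = (\<Sum>x\<in>A. x * exp x) / (\<Sum>x\<in>A. exp x)"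

text \<open>Follows from \<open>exp (v - u) \<ge> 1 + (v - u)\<close> and \<open>u \<ge> 1\<close>.
  It bounds the weighted shortfall of a distant score by that of a score at the least admissible
  distance.\<close>

lemma mult_exp_neg_antimono:
  fixes u v :: real
  assumes "1 \<le> u" "u \<le> v"
  shows "v * exp (- v) \<le> u * exp (- u)"
proof -
  have "v \<le> u * (1 + (v - u))"
    using assms mult_right_mono[of 1 u "v - u"] by (simp add: algebra_simps)
  also have "\<dots> \<le> u * exp (v - u)"
    using assms by (intro mult_left_mono exp_ge_add_one_self) auto
  finally have "v * exp (- v) \<le> u * exp (v - u) * exp (- v)"
    by (intro mult_right_mono) auto
  then show ?thesis
    by (simp add: mult.assoc flip: exp_add)
qed

text \<open>Writes the average as a reference level minus a weighted shortfall. If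
  \<open>\<mu>\<close> is the average of a subset, the terms of that subset cancel.\<close>

lemma boltzmann_eq_diff:
  assumes "finite A" "A \<noteq> {}"
  shows "boltzmann A = \<mu> - (\<Sum>x\<in>A. (\<mu> - x) * exp x) / (\<Sum>x\<in>A. exp x)"
proof -
  have "(\<Sum>x\<in>A. exp x) > 0"
    using assms by (intro sum_pos) auto
  then show ?thesis
    by (simp add: boltzmann_def field_simps sum_subtractf sum_distrib_left)
qed

lemma boltzmann_le:
  assumes "finite A" "A \<noteq> {}" "\<And>x. x \<in> A \<Longrightarrow> x \<le> b"
  shows "boltzmann A \<le> b"
proof -
  have "(\<Sum>x\<in>A. (b - x) * exp x) / (\<Sum>x\<in>A. exp x) \<ge> 0"
    using assms(3) by (intro divide_nonneg_nonneg sum_nonneg) auto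
  then show ?thesis
    using boltzmann_eq_diff[OF assms(1,2), of b] by linarith
qed

section \<open>Numerical estimates for the gap\<close>

lemma exp_3_ge_8: "exp (3 :: real) \<ge> 8"
proof -
  have "(2 :: real) ^ 3 \<le> exp 1 ^ 3"
    using exp_ge_add_one_self[of "1 :: real"] by (intro power_mono) auto
  also have "exp 1 ^ 3 = exp (3 :: real)"
    by (simp flip: exp_of_nat_mult)
  finally show ?thesis by simp
qed

text \<open>The Taylor bound \<open>1 + t + t\<^sup>2 / 2 \<le> exp t\<close> at
  \<open>t = ln x\<close>.\<close>

lemma ln_square_le:
  fixes x :: real
  assumes "x \<ge> 1"
  shows "(ln x)\<^sup>2 \<le> 2 * x"
proof -
  have "1 + ln x + (ln x)\<^sup>2 / 2 \<le> x"
    using exp_lower_Taylor_quadratic[of "ln x"] assms by simp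
  then show ?thesis
    using ln_ge_zero[OF assms] by linarith
qed

text \<open>The reason for the gap \<open>g = 2 * ln n + 3\<close>: \<open>n\<close> scores, each
  damped by \<open>exp (- g)\<close>, together weigh only
  \<open>exp (- 3) / n \<le> 1 / 8\<close>.\<close>

lemma exp_neg_gap:
  assumes "n > 0"
  shows "exp (- (2 * ln (real n) + 3)) = exp (- 3) / (real n)\<^sup>2"
  using assms by (simp add: exp_add exp_diff exp_minus field_simps exp_double power2_eq_square ln_mult
      flip: ln_realpow)

text \<open>The average of \<open>A\<close> falls short of \<open>z\<close> by at most
  \<open>n * g * exp (- g) \<le> 5 / 8\<close>, while that of \<open>B\<close> is at most
  \<open>z - g\<close> with \<open>g \<ge> 3\<close>.\<close>

lemma boltzmann_gap_top:
  fixes A B :: "real set" and n :: nat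
  defines "g \<equiv> 2 * ln (real n) + 3"
  assumes n: "n > 0" "finite A" "card A = n" "finite B" "B \<noteq> {}"
    and "z \<in> A" and A: "\<And>x. x \<in> A \<Longrightarrow> x \<noteq> z \<Longrightarrow> x < z - g"
    and B: "\<And>x. x \<in> B \<Longrightarrow> x < z - g"
  shows "boltzmann A - boltzmann B > 2"
proof -
  have g: "g \<ge> 3"
    using n(1) by (simp add: g_def)
  have "boltzmann B \<le> z - g"
    using B n by (intro boltzmann_le) (auto simp: less_imp_le)
  have Ane: "A \<noteq> {}"
    using \<open>z \<in> A\<close> by blast
  have S: "exp z \<le> (\<Sum>x\<in>A. exp x)"
    using n \<open>z \<in> A\<close> by (intro member_le_sum) auto
  have "(\<Sum>x\<in>A. (z - x) * exp x) \<le> (\<Sum>x\<in>A. exp z * (g * exp (- g)))"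
  proof (intro sum_mono)
    fix x assume "x \<in> A"
    show "(z - x) * exp x \<le> exp z * (g * exp (- g))"
    proof (cases "x = z")
      case False
      have "(z - x) * exp x = exp z * ((z - x) * exp (- (z - x)))"
        by (simp add: exp_diff exp_minus)
      also have "\<dots> \<le> exp z * (g * exp (- g))"
        using A[OF \<open>x \<in> A\<close> False] g by (intro mult_left_mono mult_exp_neg_antimono) auto
      finally show ?thesis .
    qed (use g in auto)
  qed
  also have "\<dots> = exp z * (g / real n * exp (- 3) / 1)"
    using n exp_neg_gap[of n] by (simp add: g_def power2_eq_square)
  also have "\<dots> \<le> (\<Sum>x\<in>A. exp x) * (5 / 8)"
  proof (intro mult_mono)
    have "ln (real n) \<le> real n - 1"
      using n(1) by (intro ln_le_minus_one) auto
    then have "g / real n \<le> 5"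
      using n(1) by (simp add: g_def divide_simps)
    moreover have "exp (- 3 :: real) \<le> 1 / 8"
      using exp_3_ge_8 by (simp add: exp_minus field_simps)
    ultimately have "g / real n * exp (- 3) \<le> 5 * (1 / 8)"
      using g by (intro mult_mono) auto
    then show "g / real n * exp (- 3) / 1 \<le> 5 / 8" by simp
  qed (use S g in \<open>auto intro: order.trans[OF exp_ge_zero]\<close>)
  finally have "(\<Sum>x\<in>A. (z - x) * exp x) / (\<Sum>x\<in>A. exp x) \<le> 5 / 8"
    using S less_le_trans[OF exp_gt_zero S] by (simp add: field_simps)
  then have "boltzmann A \<ge> z - 5 / 8"
    using boltzmann_eq_diff[OF n(2) Ane, of z] by linarith
  then show ?thesis
    using \<open>boltzmann B \<le> z - g\<close> g by linarith
qed

text \<open>Let \<open>\<mu>\<close> be the average of \<open>C\<close>, \<open>S\<close> its sum of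
  exponentials and \<open>y = \<mu> - z \<ge> g\<close>. Adding \<open>A\<close> lowers the average
  by at least \<open>y * exp z / (2 * S)\<close>, adding \<open>B\<close> by at most
  \<open>y * exp z / (4 * S)\<close>.\<close>

lemma boltzmann_gap_common:
  fixes A B C :: "real set" and n :: nat
  defines "g \<equiv> 2 * ln (real n) + 3"
  assumes n: "n > 0" and fin: "finite A" "finite B" "finite C" and "C \<noteq> {}"
    and disj: "C \<inter> A = {}" "C \<inter> B = {}" and card: "card B \<le> n"
    and "z \<in> A" and A: "\<And>x. x \<in> A \<Longrightarrow> x \<le> z"
    and B: "\<And>x. x \<in> B \<Longrightarrow> x < z - g" and C: "\<And>x. x \<in> C \<Longrightarrow> z + g < x"
  shows "3 / 8 * exp z / (\<Sum>x\<in>C. exp x) < boltzmann (C \<union> B) - boltzmann (C \<union> A)"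
proof -
  define S where "S = (\<Sum>x\<in>C. exp x)"
  define \<mu> where "\<mu> = boltzmann C"
  define p where "p = (\<Sum>x\<in>A. exp x)"
  define q where "q = (\<Sum>x\<in>B. exp x)"
  define P where "P = (\<Sum>x\<in>A. (\<mu> - x) * exp x)"
  define Q where "Q = (\<Sum>x\<in>B. (\<mu> - x) * exp x)"
  define y where "y = \<mu> - z"
  have g: "g \<ge> 3"
    using n by (simp add: g_def)
  obtain c where c: "c \<in> C"
    using \<open>C \<noteq> {}\<close> by blast
  have cS: "exp c \<le> S"
    unfolding S_def using c fin by (intro member_le_sum) auto
  have S: "S > 0"
    using less_le_trans[OF exp_gt_zero cS] .
  have zS: "exp z \<le> S"
    using C[OF c] g cS by (smt (verit) exp_le_cancel_iff)
  have zero: "(\<Sum>x\<in>C. (\<mu> - x) * exp x) = 0"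
    using boltzmann_eq_diff[OF fin(3) \<open>C \<noteq> {}\<close>, of \<mu>] S by (simp add: \<mu>_def S_def)
  have "(\<Sum>x\<in>C. ((z + g) - x) * exp x) / S \<le> 0"
    using C S by (intro divide_nonpos_pos sum_nonpos mult_nonpos_nonneg) (auto simp: less_imp_le)
  then have y: "y \<ge> g"
    using boltzmann_eq_diff[OF fin(3) \<open>C \<noteq> {}\<close>, of "z + g"] by (simp add: \<mu>_def S_def y_def)
  have eqA: "boltzmann (C \<union> A) = \<mu> - P / (S + p)"
    using boltzmann_eq_diff[of "C \<union> A" \<mu>] fin disj \<open>C \<noteq> {}\<close> zero
    by (simp add: sum.union_disjoint P_def p_def S_def)
  have eqB: "boltzmann (C \<union> B) = \<mu> - Q / (S + q)"
    using boltzmann_eq_diff[of "C \<union> B" \<mu>] fin disj \<open>C \<noteq> {}\<close> zero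
    by (simp add: sum.union_disjoint Q_def q_def S_def)
  have p: "exp z \<le> p"
    unfolding p_def using \<open>z \<in> A\<close> fin by (intro member_le_sum) auto
  then have p0: "p > 0"
    by (rule less_le_trans[OF exp_gt_zero])
  have q: "q \<ge> 0"
    unfolding q_def by (intro sum_nonneg) auto
  have "y * p \<le> P"
    unfolding p_def P_def sum_distrib_left y_def using A by (intro sum_mono mult_right_mono) auto
  \<comment> \<open>First \<open>exp z \<le> S\<close> is used, then that \<open>p / (S + p)\<close>
    increases with \<open>p\<close>.\<close>
  have "y * exp z / (2 * S) \<le> y * (exp z / (S + exp z))"
    using zS S y g by (simp, intro divide_left_mono) (auto intro!: mult_pos_pos add_pos_pos)
  also have "\<dots> \<le> y * (p / (S + p))"
  proof (rule mult_left_mono)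
    have "exp z * (S + p) \<le> p * (S + exp z)"
      using p S by (simp add: algebra_simps)
    then show "exp z / (S + exp z) \<le> p / (S + p)"
      using S p0 add_pos_pos[OF S exp_gt_zero[of z]] by (simp add: pos_divide_le_eq pos_le_divide_eq mult.commute)
  qed (use y g in simp)
  also have "\<dots> \<le> P / (S + p)"
    using \<open>y * p \<le> P\<close> p0 S by (simp add: divide_right_mono)
  finally have lower: "y * exp z / (2 * S) \<le> P / (S + p)" .
  \<comment> \<open>Every element of \<open>B\<close> is more than \<open>y + g\<close> below
    \<open>\<mu>\<close>, where \<open>u * exp (- u)\<close> decreases. The factor
    \<open>exp (- g)\<close> outweighs the number of elements, and
    \<open>y + g \<le> 2 * y\<close>.\<close>
  have "Q \<le> (\<Sum>x\<in>B. exp \<mu> * ((y + g) * exp (- (y + g))))"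
    unfolding Q_def
  proof (intro sum_mono)
    fix x assume "x \<in> B"
    have "(\<mu> - x) * exp x = exp \<mu> * ((\<mu> - x) * exp (- (\<mu> - x)))"
      by (simp add: exp_diff exp_minus)
    also have "\<dots> \<le> exp \<mu> * ((y + g) * exp (- (y + g)))"
      using B[OF \<open>x \<in> B\<close>] g y by (intro mult_left_mono mult_exp_neg_antimono) (auto simp: y_def)
    finally show "(\<mu> - x) * exp x \<le> exp \<mu> * ((y + g) * exp (- (y + g)))" .
  qed
  also have "\<dots> \<le> real n * (exp \<mu> * ((y + g) * exp (- (y + g))))"
    using card y g by (simp add: mult_right_mono)
  also have "\<dots> = (y + g) * exp z * (real n * exp (- g))"
    by (simp add: y_def exp_diff exp_minus exp_add field_simps)
  also have "\<dots> \<le> (2 * y) * exp z * (1 / 8)"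
  proof (intro mult_mono)
    have "real n * exp (- g) = exp (- 3) / real n"
      using n exp_neg_gap[of n] by (simp add: g_def power2_eq_square)
    also have "\<dots> \<le> exp (- 3) / 1"
      using n by (intro divide_left_mono) auto
    also have "\<dots> \<le> 1 / 8"
      using exp_3_ge_8 by (simp add: exp_minus field_simps)
    finally show "real n * exp (- g) \<le> 1 / 8" .
  qed (use y g in auto)
  finally have "Q \<le> y * exp z / 4" by simp
  moreover have "Q \<ge> 0"
    unfolding Q_def using B y g by (intro sum_nonneg mult_nonneg_nonneg) (auto simp: y_def dest!: B)
  ultimately have "Q / (S + q) \<le> (y * exp z / 4) / S"
    using q S by (intro frac_le) auto
  with lower have "y * exp z / (2 * S) - (y * exp z / 4) / S \<le> boltzmann (C \<union> B) - boltzmann (C \<union> A)"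
    unfolding eqA eqB by linarith
  moreover have "y * exp z / (2 * S) - (y * exp z / 4) / S = y / 4 * (exp z / S)"
    by simp
  moreover have "3 / 8 * (exp z / S) < y / 4 * (exp z / S)"
    using y g S by (intro mult_strict_right_mono) auto
  ultimately show ?thesis
    by (simp add: S_def)
qed

text \<open>\<open>C\<close> collects the common scores above \<open>z\<close>. Empty
  \<open>C\<close> leads to \<open>boltzmann_gap_top\<close>, nonempty \<open>C\<close> to
  \<open>boltzmann_gap_common\<close>; it remains to compare their gaps with the bound in terms of
  \<open>R\<close>.\<close>

lemma boltzmann_separation:
  fixes A B :: "real set"
  defines "L \<equiv> ln (real (card A))"
  assumes fin: "finite A" "finite B" and card: "card A = card B" and "A \<noteq> B"
    and sep: "\<And>x y. x \<in> A \<union> B \<Longrightarrow> y \<in> A \<union> B \<Longrightarrow> x \<noteq> y \<Longrightarrow> \<bar>x - y\<bar> > 2 * L + 3"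
    and bound: "\<And>x. x \<in> A \<union> B \<Longrightarrow> \<bar>x\<bar> \<le> R"
  shows "\<bar>boltzmann A - boltzmann B\<bar> > L\<^sup>2 * exp (- 2 * R)"
proof -
  define n where "n = card A"
  define z where "z = Max ((A - B) \<union> (B - A))"
  have D: "finite ((A - B) \<union> (B - A))" "(A - B) \<union> (B - A) \<noteq> {}"
    using fin \<open>A \<noteq> B\<close> by auto
  have zD: "z \<in> (A - B) \<union> (B - A)"
    unfolding z_def by (rule Max_in[OF D])
  \<comment> \<open>Stated for both orders of the sets, as \<open>z\<close> may belong to
    either.\<close>
  have main: "\<bar>boltzmann A' - boltzmann B'\<bar> > L\<^sup>2 * exp (- 2 * R)"
    if "A' = A \<and> B' = B \<or> A' = B \<and> B' = A" "z \<in> A'" "z \<notin> B'" for A' B'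
  proof -
    have fin': "finite A'" "finite B'" and card': "card A' = n" "card B' = n"
      and un: "A' \<union> B' = A \<union> B" "(A' - B') \<union> (B' - A') = (A - B) \<union> (B - A)"
      using that(1) fin card by (auto simp: n_def)
    have "n > 0"
      using card' fin' that(2) by (auto simp: card_gt_0_iff)
    have above: "x \<in> A' \<longleftrightarrow> x \<in> B'" if "x > z" for x
      using Max_ge[OF D(1), of x] that un unfolding z_def by fastforce
    define C where "C = {x \<in> A'. x > z}"
    have C: "C \<subseteq> A'" "C \<subseteq> B'" "finite C"
      using above fin' by (auto simp: C_def)
    have sep': "\<bar>x - y\<bar> > 2 * ln (real n) + 3" if "x \<in> A' \<union> B'" "y \<in> A' \<union> B'" "x \<noteq> y" for x y
      using sep[of x y] that un by (simp add: L_def n_def)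
    have low: "x < z - (2 * ln (real n) + 3)" if "x \<in> (A' \<union> B') - C" "x \<noteq> z" for x
      using sep'[of x z] that \<open>z \<in> A'\<close> above by (force simp: C_def)
    have high: "z + (2 * ln (real n) + 3) < x" if "x \<in> C" for x
      using sep'[of x z] that \<open>z \<in> A'\<close> by (force simp: C_def)
    \<comment> \<open>Equal cardinalities force \<open>B'\<close> to have an element outside
      \<open>C\<close> too, and it lies more than a gap below \<open>z\<close>.\<close>
    have "card (A' - C) > 0"
      using that(2) fin' by (auto simp: card_gt_0_iff C_def)
    then have "card (B' - C) > 0"
      using C card' by (simp add: card_Diff_subset)
    then obtain b where b: "b \<in> B'" "b \<notin> C"
      by (metis Diff_iff all_not_in_conv card.empty less_irrefl)
    have bz: "b < z - (2 * ln (real n) + 3)"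
      using low[of b] b that(3) by auto
    have L2: "L\<^sup>2 \<le> 2 * real n"
      unfolding L_def n_def[symmetric] using \<open>n > 0\<close> by (intro ln_square_le) auto
    \<comment> \<open>\<open>c - b\<close> is at most \<open>2 * R\<close> and exceeds
      \<open>c - z\<close> by more than the gap. This surplus absorbs the factor
      \<open>L\<^sup>2 \<le> 2 * n\<close>.\<close>
    have R: "L\<^sup>2 * exp (- 2 * R) \<le> exp (z - c) / (4 * real n)" if c: "c \<in> A'" for c
    proof -
      have "b \<in> A \<union> B" "c \<in> A \<union> B"
        using b c un by blast+
      then have "- 2 * R \<le> b - c"
        using bound[of b] bound[of c] by linarith
      also have "\<dots> \<le> (z - c) + - (2 * ln (real n) + 3)"
        using bz by linarith
      finally have "exp (- 2 * R) \<le> exp (z - c) * exp (- (2 * ln (real n) + 3))"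
        by (simp flip: exp_add)
      then have "L\<^sup>2 * exp (- 2 * R) \<le> (2 * real n) * (exp (z - c) * exp (- (2 * ln (real n) + 3)))"
        using L2 by (intro mult_mono) auto
      also have "\<dots> = exp (z - c) * (2 * exp (- 3)) / real n"
        unfolding exp_neg_gap[OF \<open>n > 0\<close>] using \<open>n > 0\<close> by (simp add: power2_eq_square)
      also have "\<dots> \<le> exp (z - c) * (1 / 4) / real n"
        using exp_3_ge_8 by (intro divide_right_mono mult_left_mono) (auto simp: exp_minus field_simps)
      finally show ?thesis by simp
    qed
    show ?thesis
    proof (cases "C = {}")
      case True
      have "L\<^sup>2 * exp (- 2 * R) \<le> 1 / (4 * real n)"
        using R[OF \<open>z \<in> A'\<close>] by simp
      also have "\<dots> \<le> 1"
        using \<open>n > 0\<close> by simp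
      finally have "L\<^sup>2 * exp (- 2 * R) \<le> 1" .
      moreover have "boltzmann A' - boltzmann B' > 2"
        using low True b that(2,3) \<open>n > 0\<close> fin' card'
        by (intro boltzmann_gap_top[of n A' B' z]) auto
      ultimately show ?thesis by linarith
    next
      case False
      define c where "c = Max C"
      have c: "c \<in> C" "\<And>x. x \<in> C \<Longrightarrow> x \<le> c"
        unfolding c_def using C(3) False by auto
      have "(\<Sum>x\<in>C. exp x) \<le> (\<Sum>x\<in>C. exp c)"
        using c by (intro sum_mono) auto
      also have "\<dots> \<le> real n * exp c"
        using card_mono[OF fin'(1) C(1)] card' by (simp add: mult_right_mono)
      finally have S: "(\<Sum>x\<in>C. exp x) \<le> real n * exp c" .
      have "(\<Sum>x\<in>C. exp x) > 0"
        using C(3) False by (intro sum_pos) auto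
      have "L\<^sup>2 * exp (- 2 * R) \<le> 1 / 4 * exp z / (real n * exp c)"
        using R[of c] c(1) C(1) by (simp add: exp_diff subset_iff mult_ac)
      also have "\<dots> \<le> 1 / 4 * exp z / (\<Sum>x\<in>C. exp x)"
        using S \<open>(\<Sum>x\<in>C. exp x) > 0\<close> by (intro divide_left_mono) auto
      also have "\<dots> \<le> 3 / 8 * exp z / (\<Sum>x\<in>C. exp x)"
        using \<open>(\<Sum>x\<in>C. exp x) > 0\<close> by (intro divide_right_mono) auto
      also have "\<dots> < boltzmann (C \<union> (B' - C)) - boltzmann (C \<union> (A' - C))"
      proof (rule boltzmann_gap_common[of n])
        show "card (B' - C) \<le> n"
          using card' fin' by (metis card_mono Diff_subset)
        show "x \<le> z" if "x \<in> A' - C" for x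
          using that by (auto simp: C_def)
      qed (use \<open>n > 0\<close> fin' C False that(2,3) low high in \<open>auto simp: C_def\<close>)
      also have "C \<union> (B' - C) = B'"
        using C by auto
      also have "C \<union> (A' - C) = A'"
        using C by auto
      finally show ?thesis by linarith
    qed
  qed
  show ?thesis
    using zD main[of A B] main[of B A] by (auto simp: abs_minus_commute)
qed

section \<open>Attention with rank-one weights\<close>

definition outer :: "real ^ 'm \<Rightarrow> real ^ 'n \<Rightarrow> real ^ 'n ^ 'm" where
  "outer u w = (\<chi> i j. u $ i * w $ j)"

lemma outer_mult_vector: "outer u w *v x = (w \<bullet> x) *\<^sub>R u"
  by (simp add: outer_def vec_eq_iff matrix_vector_mult_def inner_vec_def sum_distrib_left mult_ac)

lemma outer_matrix_mult: "outer u w ** A = outer u (\<chi> j. w \<bullet> column j A)"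
  by (simp add: outer_def vec_eq_iff matrix_matrix_mult_def inner_vec_def column_def
      sum_distrib_left mult.assoc)

lemma transpose_outer: "transpose (outer u w) = outer w u"
  by (simp add: outer_def vec_eq_iff transpose_def mult.commute)

lemma column_outer: "column j (outer u w) = w $ j *\<^sub>R u"
  by (simp add: outer_def vec_eq_iff column_def)

lemma rank_outer:
  assumes "u \<noteq> 0" "w \<noteq> 0"
  shows "rank (outer u w) = 1"
proof -
  have "range (\<lambda>x. outer u w *v x) = span {u}"
  proof (intro equalityI subsetI)
    fix y assume "y \<in> span {u}"
    then obtain k where "y = k *\<^sub>R u"
      by (auto simp: span_singleton)
    then have "y = outer u w *v ((k / (w \<bullet> w)) *\<^sub>R w)"
      using assms(2) by (simp add: outer_mult_vector)
    then show "y \<in> range (\<lambda>x. outer u w *v x)"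
      by blast
  qed (auto simp: outer_mult_vector span_singleton)
  then show ?thesis
    using assms(1) by (simp add: rank_dim_range dim_singleton)
qed

lemma sum_softmax: "(\<Sum>i\<in>UNIV. softmax a $ i) = 1"
proof -
  have "(\<Sum>i\<in>UNIV. exp (a $ i)) > 0"
    by (intro sum_pos) auto
  then show ?thesis
    by (simp add: softmax_def flip: sum_divide_distrib)
qed

lemma softmax_nonneg: "softmax a $ i \<ge> 0"
  by (simp add: softmax_def sum_nonneg)

lemma abs_inner_softmax_le:
  assumes "\<And>i. \<bar>z $ i\<bar> \<le> b"
  shows "\<bar>z \<bullet> softmax a\<bar> \<le> b"
proof -
  have "\<bar>z \<bullet> softmax a\<bar> \<le> (\<Sum>i\<in>UNIV. \<bar>z $ i * softmax a $ i\<bar>)"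
    unfolding inner_vec_def inner_real_def by (rule sum_abs)
  also have "\<dots> \<le> (\<Sum>i\<in>UNIV. b * softmax a $ i)"
    using assms by (intro sum_mono) (auto simp: abs_mult softmax_nonneg intro!: mult_right_mono)
  also have "\<dots> = b"
    by (simp add: sum_softmax flip: sum_distrib_left)
  finally show ?thesis .
qed

text \<open>Injectivity turns sums over positions into sums over the set of values.\<close>

lemma inner_softmax_eq_boltzmann:
  assumes "inj (\<lambda>i. a $ i)"
  shows "a \<bullet> softmax a = boltzmann (range (\<lambda>i. a $ i))"
  using assms by (simp add: boltzmann_def sum.reindex inner_vec_def softmax_def sum_divide_distrib)

text \<open>Because \<open>e \<bullet> e = 1\<close>, the inner dimension collapses: the score
  matrix is the outer product of \<open>z\<close> and \<open>c *\<^sub>R z\<close>, the value part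
  that of \<open>u\<close> and \<open>z\<close>.\<close>

lemma column_self_attention_outer:
  fixes Z :: "real ^ 'n ^ 'd" and v u :: "real ^ 'd" and e :: "real ^ 's" and c :: real
  assumes "norm e = 1"
  defines "z \<equiv> (\<chi> j. v \<bullet> column j Z)"
  shows "column k (self_attention (outer u e) (outer e v) (outer e v) (outer (c *\<^sub>R e) v) Z)
         = column k Z + (z \<bullet> softmax ((c * z $ k) *\<^sub>R z)) *\<^sub>R u"
proof -
  have e: "e \<bullet> e = 1"
    using assms(1) by (simp add: dot_square_norm)
  have 1: "outer u e ** (outer e v ** Z) = outer u z"
    by (simp add: outer_matrix_mult column_outer e z_def)
  have 2: "transpose (outer e v ** Z) ** (outer (c *\<^sub>R e) v ** Z) = outer z (c *\<^sub>R z)"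
    by (simp add: outer_matrix_mult transpose_outer column_outer e vec_eq_iff flip: z_def)
       (simp add: outer_def)
  have 3: "column k (softmax_columns (outer z (c *\<^sub>R z))) = softmax ((c * z $ k) *\<^sub>R z)"
    by (simp add: softmax_columns_def column_outer vec_eq_iff) (simp add: column_def column_outer)
  have "column k (A + B) = column k A + column k B" for A B :: "real ^ 'n ^ 'd"
    by (simp add: column_def vec_eq_iff)
  then show ?thesis
    unfolding self_attention_def 1 2 by (simp add: outer_matrix_mult column_outer 3)
qed

section \<open>Choice of the weights and verification of both conditions\<close>

theorem theorem2:
  fixes X :: "nat \<Rightarrow> real ^ 'n ^ 'd"
    and N :: nat
    and rmin rmax \<epsilon> r \<delta> D L :: real
  assumes "N \<ge> 1"
    and "rmax > rmin" and "rmin > 0" and "\<epsilon> > 0"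
    and no_duplicates: "\<And>i k l. i \<in> {1..N} \<Longrightarrow> k \<noteq> l \<Longrightarrow> column k (X i) \<noteq> column l (X i)"
    and "tokenwise_separated rmin rmax \<epsilon> N X"
  defines "L \<equiv> ln (real CARD('n))"
    and "D \<equiv> (real (card (vocabulary N X)) + 1) ^ 4 * (2 * L + 3) * pi * real CARD('d)"
    and "r \<equiv> rmax + \<epsilon> / 4"
    and "\<delta> \<equiv> 2 * L\<^sup>2 * \<epsilon>\<^sup>2 * rmin / (rmax\<^sup>2 * D) * exp (- (D * rmax\<^sup>2 / (4 * \<epsilon> * rmin)))"
  shows "\<exists>(WO :: real ^ 's ^ 'd) (WV :: real ^ 'd ^ 's) (WK :: real ^ 'd ^ 's) (WQ :: real ^ 'd ^ 's).
           rank WV = 1 \<and> rank WK = 1 \<and> rank WQ = 1 \<and>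
           contextual_mapping r \<delta> N X (self_attention WO WV WK WQ)"
proof -
  define V where "V = vocabulary N X"
  \<comment> \<open>\<open>M\<close> counts the tokens and the vector 0, which is included so that
    \<open>v\<close> also bounds \<open>\<bar>v \<bullet> x\<bar>\<close> from below.\<close>
  define M where "M = real (card V) + 1"
  define d where "d = real CARD('d)"
  define \<kappa> where "\<kappa> = sqrt (8 / (pi * d)) / M ^ 2"
  \<comment> \<open>\<open>c\<close> solves
    \<open>c * \<kappa>\<^sup>2 * rmin * \<epsilon> = 2 * L + 3\<close>, which puts different scores
    more than the gap apart. By \<open>b * rmax = \<epsilon> / 4\<close>, no token is shifted by
    more than \<open>\<epsilon> / 4\<close>.\<close>
  define c where "c = D / (8 * \<epsilon> * rmin)"
  define b where "b = \<epsilon> / (4 * rmax)"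
  have cols: "columns (X i) = range (\<lambda>k. column k (X i))" for i
    by (auto simp: columns_def)
  have finV: "finite V"
    by (simp add: V_def vocabulary_def cols)
  have inV: "column k (X i) \<in> V" if "i \<in> {1..N}" for i k
    using that unfolding V_def vocabulary_def cols by blast
  have colsV: "columns (X i) \<subseteq> V" if "i \<in> {1..N}" for i
    using inV[OF that] by (auto simp: cols)
  have V: "rmin < norm x" "norm x < rmax" if "x \<in> V" for x
    using assms(6) that by (auto simp: V_def vocabulary_def cols tokenwise_separated_def)
  have sepV: "norm (x - y) > \<epsilon>" if "x \<in> V" "y \<in> V" "x \<noteq> y" for x y
    using assms(6) that by (auto simp: V_def vocabulary_def cols tokenwise_separated_def)
  have card_cols: "card (columns (X i)) = CARD('n)" if "i \<in> {1..N}" for i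
    using no_duplicates[OF that] unfolding cols by (intro card_image) (auto simp: inj_def)
  have "1 \<in> {1..N}"
    using assms(1) by simp
  \<comment> \<open>One sequence without duplicates already contributes \<open>n\<close>
    tokens.\<close>
  then have nM: "real CARD('n) + 1 \<le> M"
    unfolding M_def using card_mono[OF finV colsV[of 1]] card_cols[of 1] by simp
  have n1: "real CARD('n) \<ge> 1"
    by (simp add: Suc_leI)
  have M2: "M \<ge> 2"
    using nM n1 by linarith
  have L0: "L \<ge> 0"
    unfolding L_def using n1 by simp
  have d1: "d \<ge> 1"
    unfolding d_def by (simp add: Suc_leI)
  have D: "D = M ^ 4 * (2 * L + 3) * pi * d"
    by (simp add: D_def M_def V_def d_def)
  have D0: "D > 0"
    unfolding D using M2 L0 d1 by (intro mult_pos_pos) auto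
  have \<kappa>0: "\<kappa> > 0"
    unfolding \<kappa>_def using M2 d1 by (intro divide_pos_pos) auto
  have c0: "c > 0"
    unfolding c_def using D0 assms(3,4) by simp
  have \<kappa>2: "\<kappa>\<^sup>2 = 8 / (pi * d) / M ^ 4"
    using d1 by (simp add: \<kappa>_def power_divide flip: power_mult)
  have c\<kappa>: "c * \<kappa>\<^sup>2 * rmin * \<epsilon> = 2 * L + 3"
    unfolding c_def \<kappa>2 D using M2 d1 assms(3,4) by simp
  have "0 \<notin> V"
    using V(1)[of 0] assms(3) by auto
  then have cW: "real (card (insert 0 V)) = M"
    using finV by (simp add: M_def)
  obtain v where v1: "norm v = 1"
    and "\<And>x y. x \<in> insert 0 V \<Longrightarrow> y \<in> insert 0 V \<Longrightarrow>
       sqrt (8 / (pi * real CARD('d))) / real (card (insert 0 V)) ^ 2 * norm (x - y) \<le> \<bar>v \<bullet> (x - y)\<bar>"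
    using exists_separating_direction[of "insert 0 V"] finV by blast
  then have v: "\<kappa> * norm (x - y) \<le> \<bar>v \<bullet> (x - y)\<bar>" if "x \<in> insert 0 V" "y \<in> insert 0 V" for x y
    using that unfolding cW \<kappa>_def d_def by blast
  have vlow: "\<kappa> * rmin < \<bar>v \<bullet> x\<bar>" if "x \<in> V" for x
  proof -
    have "\<kappa> * rmin < \<kappa> * norm x"
      using V(1)[OF that] \<kappa>0 by simp
    also have "\<dots> \<le> \<bar>v \<bullet> x\<bar>"
      using v[of x 0] that by simp
    finally show ?thesis .
  qed
  have vup: "\<bar>v \<bullet> x\<bar> < rmax" if "x \<in> V" for x
    using Cauchy_Schwarz_ineq2[of v x] v1 V(2)[OF that] by simp
  have vsep: "\<kappa> * \<epsilon> < \<bar>v \<bullet> x - v \<bullet> y\<bar>" if "x \<in> V" "y \<in> V" "x \<noteq> y" for x y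
  proof -
    have "\<kappa> * \<epsilon> < \<kappa> * norm (x - y)"
      using sepV[OF that] \<kappa>0 by simp
    also have "\<dots> \<le> \<bar>v \<bullet> x - v \<bullet> y\<bar>"
      using v[of x y] that by (simp add: inner_diff_right)
    finally show ?thesis .
  qed
  \<comment> \<open>Only the length of \<open>u\<close> matters; its direction is arbitrary.\<close>
  define u :: "real ^ 'd" where "u = b *\<^sub>R axis undefined 1"
  define e :: "real ^ 's" where "e = axis undefined 1"
  have b0: "b > 0"
    unfolding b_def using assms(2-4) by simp
  have nu: "norm u = b"
    using b0 by (simp add: u_def)
  have ne: "norm e = 1"
    by (simp add: e_def)
  define z where "z i = (\<chi> j. v \<bullet> column j (X i))" for i
  define \<alpha> where "\<alpha> i k = z i \<bullet> softmax ((c * z i $ k) *\<^sub>R z i)" for i k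
  define F :: "real ^ 'n ^ 'd \<Rightarrow> real ^ 'n ^ 'd" where
    "F = self_attention (outer u e) (outer e v) (outer e v) (outer (c *\<^sub>R e) v)"
  have F: "column k (F (X i)) = column k (X i) + \<alpha> i k *\<^sub>R u" for i k
    unfolding F_def \<alpha>_def z_def by (rule column_self_attention_outer[OF ne])
  have \<alpha>u: "norm (\<alpha> i k *\<^sub>R u) \<le> \<epsilon> / 4" if "i \<in> {1..N}" for i k
  proof -
    have "\<bar>\<alpha> i k\<bar> \<le> rmax"
      unfolding \<alpha>_def using vup[OF inV[OF that]]
      by (intro abs_inner_softmax_le) (simp add: z_def less_imp_le)
    then have "\<bar>\<alpha> i k\<bar> * b \<le> rmax * b"
      using b0 by (intro mult_right_mono) auto
    then show ?thesis
      using assms(2,3) by (simp add: nu) (simp add: b_def)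
  qed
  \<comment> \<open>\<open>\<alpha> i k\<close> averages the unscaled values
    \<open>v \<bullet> y\<close> with weights from the scaled scores. Multiplying by the scale makes
    values and scores agree.\<close>
  have \<alpha>_boltzmann:
    "c * (v \<bullet> column k (X i)) * \<alpha> i k
       = boltzmann ((\<lambda>x. c * (v \<bullet> column k (X i)) * (v \<bullet> x)) ` columns (X i))"
    if i: "i \<in> {1..N}" for i k
  proof -
    define s where "s = c * (v \<bullet> column k (X i))"
    have "s \<noteq> 0"
      using vlow[OF inV[OF i], of k] c0 mult_pos_pos[OF \<kappa>0 assms(3)] by (auto simp: s_def)
    have "inj (\<lambda>j. (s *\<^sub>R z i) $ j)"
    proof (rule injI)
      fix j l assume "(s *\<^sub>R z i) $ j = (s *\<^sub>R z i) $ l"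
      then have "v \<bullet> column j (X i) = v \<bullet> column l (X i)"
        using \<open>s \<noteq> 0\<close> by (simp add: z_def)
      then show "j = l"
        using vsep[OF inV[OF i] inV[OF i], of j l] no_duplicates[OF i, of j l] mult_pos_pos[OF \<kappa>0 assms(4)]
        by force
    qed
    then have "(s *\<^sub>R z i) \<bullet> softmax (s *\<^sub>R z i) = boltzmann (range (\<lambda>j. (s *\<^sub>R z i) $ j))"
      by (rule inner_softmax_eq_boltzmann)
    moreover have "range (\<lambda>j. (s *\<^sub>R z i) $ j) = (\<lambda>x. s * (v \<bullet> x)) ` columns (X i)"
      by (auto simp: cols z_def)
    ultimately show ?thesis
      by (simp add: s_def \<alpha>_def) (simp add: z_def)
  qed
  have key: "norm (column k (F (X i)) - column l (F (X j))) > \<delta>"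
    if ij: "i \<in> {1..N}" "j \<in> {1..N}"
      and neq: "columns (X i) \<noteq> columns (X j) \<or> column k (X i) \<noteq> column l (X j)" for i j k l
  proof (cases "column k (X i) = column l (X j)")
    case False
    let ?x = "column k (X i)" and ?y = "column l (X j)"
    have "\<epsilon> < norm (?x - ?y)"
      using sepV[OF inV[OF ij(1)] inV[OF ij(2)] False] .
    moreover have "norm (?x - ?y) \<le> norm ?x + norm ?y"
      by (rule norm_triangle_ineq4)
    ultimately have "\<epsilon> < 2 * rmax"
      using V(2)[OF inV[OF ij(1)], of k] V(2)[OF inV[OF ij(2)], of l] by linarith
    \<comment> \<open>This yields \<open>\<delta> \<le> \<epsilon> / 2\<close>, while the two shifts
      use up at most the other half of the distance \<open>\<epsilon>\<close>.\<close>
    have "4 * L\<^sup>2 * \<epsilon> * rmin \<le> rmax\<^sup>2 * D"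
    proof -
      have "8 * L\<^sup>2 \<le> 16 * M"
        using ln_square_le[OF n1] nM by (simp add: L_def)
      also have "\<dots> \<le> M ^ 4 * 3 * 3 * 1"
      proof -
        have "2 * 2 * 2 * M \<le> M * M * M * M"
          using M2 by (intro mult_mono) auto
        then show ?thesis
          using M2 by (simp add: power4_eq_xxxx)
      qed
      also have "\<dots> \<le> D"
        unfolding D using M2 L0 d1 pi_gt3 by (intro mult_mono) auto
      finally have "8 * L\<^sup>2 \<le> D" .
      have "4 * L\<^sup>2 * \<epsilon> * rmin \<le> 4 * L\<^sup>2 * (2 * rmax) * rmax"
        using \<open>\<epsilon> < 2 * rmax\<close> assms(2-4) by (intro mult_mono) auto
      also have "\<dots> = rmax\<^sup>2 * (8 * L\<^sup>2)"
        by (simp add: power2_eq_square)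
      also have "\<dots> \<le> rmax\<^sup>2 * D"
        using \<open>8 * L\<^sup>2 \<le> D\<close> by (intro mult_left_mono) auto
      finally show ?thesis .
    qed
    then have "4 * L\<^sup>2 * \<epsilon> * rmin * \<epsilon> \<le> rmax\<^sup>2 * D * \<epsilon>"
      using assms(4) by (intro mult_right_mono) auto
    then have "2 * L\<^sup>2 * \<epsilon>\<^sup>2 * rmin / (rmax\<^sup>2 * D) \<le> \<epsilon> / 2"
      using D0 assms(2,3) by (simp add: pos_divide_le_eq power2_eq_square mult_ac)
    then have "\<delta> \<le> \<epsilon> / 2 * 1"
      unfolding \<delta>_def using D0 assms(2-4) by (intro mult_mono) auto
    also have "\<dots> < norm (?x - ?y) - norm (\<alpha> i k *\<^sub>R u) - norm (\<alpha> j l *\<^sub>R u)"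
      using \<open>\<epsilon> < norm (?x - ?y)\<close> \<alpha>u[OF ij(1), of k] \<alpha>u[OF ij(2), of l] by linarith
    also have "\<dots> \<le> norm (column k (F (X i)) - column l (F (X j)))"
    proof -
      have "norm (p - q) - norm a - norm a' \<le> norm (p + a - (q + a'))" for p q a a' :: "real ^ 'd"
        by norm
      then show ?thesis
        unfolding F .
    qed
    finally show ?thesis .
  next
    case True
    \<comment> \<open>Both queries are the same token \<open>x\<close>, so a single score function
      \<open>f\<close> serves both sequences. It is injective on \<open>V\<close>, hence different
      vocabularies give different score sets.\<close>
    define x where "x = column k (X i)"
    define s where "s = c * (v \<bullet> x)"
    define R where "R = c * rmax\<^sup>2"
    define f where "f y = s * (v \<bullet> y)" for y
    let ?A = "f ` columns (X i)" and ?B = "f ` columns (X j)"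
    have x: "x \<in> V" "column k (X i) = x" "column l (X j) = x"
      using inV[OF ij(1), of k] True by (auto simp: x_def)
    have s: "\<bar>s\<bar> < c * rmax" "c * (\<kappa> * rmin) < \<bar>s\<bar>"
      using vlow[OF x(1)] vup[OF x(1)] c0 by (auto simp: s_def abs_mult)
    have s0: "\<bar>s\<bar> > 0"
      using s(2) c0 \<kappa>0 assms(3) by (smt (verit) mult_pos_pos)
    have fsep: "2 * L + 3 < \<bar>f y - f y'\<bar>" if "y \<in> V" "y' \<in> V" "y \<noteq> y'" for y y'
    proof -
      have "2 * L + 3 = (c * (\<kappa> * rmin)) * (\<kappa> * \<epsilon>)"
        using c\<kappa> by (simp add: power2_eq_square mult_ac)
      also have "\<dots> < \<bar>s\<bar> * \<bar>v \<bullet> y - v \<bullet> y'\<bar>"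
        using s(2) s0 vsep[OF that] c0 \<kappa>0 assms(3,4) by (intro mult_strict_mono) auto
      also have "\<dots> = \<bar>f y - f y'\<bar>"
        by (simp add: f_def abs_mult flip: right_diff_distrib)
      finally show ?thesis .
    qed
    have inj: "inj_on f V"
    proof (rule inj_onI)
      fix y y' assume "y \<in> V" "y' \<in> V" "f y = f y'"
      then show "y = y'"
        using fsep[of y y'] L0 by force
    qed
    have cardA: "card ?A = CARD('n)" and cardB: "card ?B = CARD('n)"
      using card_image[OF inj_on_subset[OF inj colsV]] card_cols ij by auto
    have fbound: "\<bar>f y\<bar> \<le> R" if "y \<in> V" for y
    proof -
      have "\<bar>f y\<bar> \<le> (c * rmax) * rmax"
        unfolding f_def abs_mult using s(1) vup[OF that] c0 assms(2,3) by (intro mult_mono) auto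
      then show ?thesis
        by (simp add: R_def power2_eq_square)
    qed
    have "L\<^sup>2 * exp (- 2 * R) < \<bar>boltzmann ?A - boltzmann ?B\<bar>"
    proof -
      have "?A \<noteq> ?B"
        using neq True inj_on_image_eq_iff[OF inj colsV[OF ij(1)] colsV[OF ij(2)]] by auto
      moreover have "\<exists>x'\<in>V. y = f x'" if "y \<in> ?A \<union> ?B" for y
        using that colsV ij by blast
      moreover have "finite ?A" "finite ?B"
        by (simp_all add: cols)
      ultimately show ?thesis
        using boltzmann_separation[of ?A ?B R] fsep fbound
        unfolding cardA cardB L_def[symmetric] by metis
    qed
    also have "\<dots> = \<bar>s\<bar> * \<bar>\<alpha> i k - \<alpha> j l\<bar>"
      using \<alpha>_boltzmann[OF ij(1), of k] \<alpha>_boltzmann[OF ij(2), of l]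
      by (simp add: f_def[abs_def] s_def x right_diff_distrib flip: abs_mult)
    \<comment> \<open>The bound on the scale \<open>s\<close> turns the gap between Boltzmann
      averages into one between the \<open>\<alpha>\<close> values.\<close>
    also have "\<dots> \<le> (c * rmax) * \<bar>\<alpha> i k - \<alpha> j l\<bar>"
      using s(1) by (intro mult_right_mono) auto
    finally have "L\<^sup>2 * exp (- 2 * R) * b / (c * rmax) < \<bar>\<alpha> i k - \<alpha> j l\<bar> * b"
      using c0 b0 assms(2,3) by (simp add: pos_divide_less_eq mult_ac)
    \<comment> \<open>Here \<open>b / (c * rmax) = 2 * \<epsilon>\<^sup>2 * rmin / (rmax\<^sup>2 *
      D)\<close> and \<open>2 * R = D * rmax\<^sup>2 / (4 * \<epsilon> * rmin)\<close>.\<close>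
    moreover have "\<delta> = L\<^sup>2 * exp (- 2 * R) * b / (c * rmax)"
      unfolding \<delta>_def R_def c_def b_def using D0 assms(2-4) by (simp add: field_simps power2_eq_square)
    moreover have "norm (column k (F (X i)) - column l (F (X j))) = \<bar>\<alpha> i k - \<alpha> j l\<bar> * b"
      unfolding F x by (simp add: nu flip: scaleR_diff_left)
    ultimately show ?thesis by simp
  qed
  have "norm (column k (F (X i))) < r" if i: "i \<in> {1..N}" for i k
    using norm_triangle_ineq[of "column k (X i)" "\<alpha> i k *\<^sub>R u"] \<alpha>u[OF i, of k] V(2)[OF inV[OF i], of k]
    unfolding F r_def by linarith
  with key have "contextual_mapping r \<delta> N X F"
    unfolding contextual_mapping_def by blast
  moreover have "rank (outer e v) = 1"
    using v1 ne by (intro rank_outer) auto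
  moreover have "rank (outer (c *\<^sub>R e) v) = 1"
    using v1 ne c0 by (intro rank_outer) auto
  ultimately show ?thesis
    unfolding F_def by blast
qed

end
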